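(* In the Merton problem with hyperbolic discounting, one can find a hyperbolic discount function such that the consumption rate policy is neither increasing nor decreasing in time. Precisely: there exist parameters $T>0$, $r>0$, $\mu>0$, $\sigma>0$, $n>0$, $\gamma<1$ with $\gamma\ne0$, and $k_1,k_2>0$ such that, for the discount function $h(t)=(1+k_1t)^{-k_2/k_1}$, the consumption rate policy $t\mapsto (a(t))^{\frac1{\gamma-1}}$ is neither an increasing nor a decreasing function on $[0,T]$, where $a$ is the positive $C^1$ solution on $[0,T]$ of $$a(t)=\int_t^Th(s-t)(a(s))^{\frac{\gamma}{\gamma-1}}e^{K(s-t)-\gamma\int_t^s(a(z))^{\frac1{\gamma-1}}dz}\,ds+n\,h(T-t)\,e^{K(T-t)-\gamma\int_t^T(a(z))^{\frac1{\gamma-1}}dz},\qquad a(T)=n,$$ with $K=\gamma\big(r+\frac{\mu^2}{2(1-\gamma)\sigma^2}\big)$.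
   Context: Setting: an investor with CRRA utility $U_\gamma(x)=x^\gamma/\gamma$ invests on $[0,T]$ in a riskless asset with rate $r$ and a stock with excess return $\mu$ and volatility $\sigma$, and consumes; there is no income, no life insurance and no death before $T$. The expected utility at time $t$ with wealth $x$ is $\mathbb E[\int_t^Th(s-t)U_\gamma(c(s))ds+n\,h(T-t)U_\gamma(X(T))\mid X(t)=x]$. The equilibrium (time-consistent) policy consumes $F_2(t,x)=(a(t))^{1/(\gamma-1)}x$ at time $t$ with wealth $x$, where $a$ solves the integral equation in the claim; the consumption rate policy is $F_2(t,x)/x=(a(t))^{1/(\gamma-1)}$. *)

theory Defs
  imports "HOL-Analysis.Analysis"
begin

definition hyperbolic_discount :: "real \<Rightarrow> real \<Rightarrow> real \<Rightarrow> real" where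
  "hyperbolic_discount k1 k2 t = (1 + k1 * t) powr (- k2 / k1)"

definition merton_K :: "real \<Rightarrow> real \<Rightarrow> real \<Rightarrow> real \<Rightarrow> real" where
  "merton_K r \<mu> \<sigma> \<gamma> = \<gamma> * (r + \<mu>\<^sup>2 / (2 * (1 - \<gamma>) * \<sigma>\<^sup>2))"

definition consumption_rate :: "real \<Rightarrow> (real \<Rightarrow> real) \<Rightarrow> real \<Rightarrow> real" where
  "consumption_rate \<gamma> a t = a t powr (1 / (\<gamma> - 1))"

text \<open>
  Derivatives are taken within the interval, hence one-sided at the two endpoints, so that
  the property depends only on the values of the function on the interval.
\<close>
definition C1_on_interval :: "real \<Rightarrow> real \<Rightarrow> (real \<Rightarrow> real) \<Rightarrow> bool" where
  "C1_on_interval u v f \<longleftrightarrow>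
    (\<exists>f'. (\<forall>t\<in>{u..v}. (f has_real_derivative f' t) (at t within {u..v})) \<and>
          continuous_on {u..v} f')"

definition equilibrium_solution ::
  "(real \<Rightarrow> real) \<Rightarrow> real \<Rightarrow> real \<Rightarrow> real \<Rightarrow> real \<Rightarrow> (real \<Rightarrow> real) \<Rightarrow> bool" where
  "equilibrium_solution h K T n \<gamma> a \<longleftrightarrow>
    C1_on_interval 0 T a \<and>
    (\<forall>t\<in>{0..T}. a t > 0) \<and>
    (\<forall>t\<in>{0..T}.
       a t =
         integral {t..T} (\<lambda>s. h (s - t) * a s powr (\<gamma> / (\<gamma> - 1)) *
             exp (K * (s - t) - \<gamma> * integral {t..s} (\<lambda>z. a z powr (1 / (\<gamma> - 1))))) +
         n * h (T - t) *
             exp (K * (T - t) - \<gamma> * integral {t..T} (\<lambda>z. a z powr (1 / (\<gamma> - 1))))) \<and>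
    a T = n"

end

theory Submission
  imports Defs
begin

text \<open>
  As \<open>\<gamma> \<rightarrow> 0\<close> (logarithmic utility) the equation loses its dependence on the unknown, and
  \<open>a\<close> tends to \<open>\<integral>\<^sub>t\<^sup>T h(s - t) ds + n h(T - t)\<close>. For \<open>h(t) = (1 + k t)\<^sup>-\<^sup>2\<close> and \<open>y = 1 / (1 + k (T - t))\<close>
  this limit is \<open>(n k y\<^sup>2 + 1 - y) / k\<close>, a parabola in \<open>y\<close>; with \<open>k = 1/24\<close>, \<open>n = 18\<close>, \<open>T = 48\<close> it takes
  the values 18, 16, 18 at the times 0, 36, 48. For \<open>\<gamma> < 0\<close> close to 0 the right-hand side of the
  equation is a contraction on a suitable set of continuous functions, any solution lies in that
  set, and the solution is uniformly close to the limit.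
\<close>

section \<open>Closure properties of C1 functions on an interval\<close>

lemma C1_on_interval_cong:
  assumes "C1_on_interval u v f" and "\<And>t. t \<in> {u..v} \<Longrightarrow> f t = g t"
  shows "C1_on_interval u v g"
proof -
  obtain f' where f': "\<forall>t\<in>{u..v}. (f has_real_derivative f' t) (at t within {u..v})"
      "continuous_on {u..v} f'"
    using assms(1) unfolding C1_on_interval_def by blast
  have "(g has_real_derivative f' t) (at t within {u..v})" if "t \<in> {u..v}" for t
    using has_field_derivative_transform_within[of f "f' t" t "{u..v}" 1 g] f' assms(2) that by auto
  then show ?thesis unfolding C1_on_interval_def using f'(2) by blast
qed

lemma C1_on_interval_continuous:
  assumes "C1_on_interval u v f"
  shows "continuous_on {u..v} f"
  using assms unfolding C1_on_interval_def
  by (meson DERIV_continuous continuous_on_eq_continuous_within)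

lemma C1_on_interval_const: "C1_on_interval u v (\<lambda>t. c)"
  unfolding C1_on_interval_def by (intro exI[of _ "\<lambda>_. 0"]) auto

lemma C1_on_interval_ident: "C1_on_interval u v (\<lambda>t. t)"
  unfolding C1_on_interval_def by (intro exI[of _ "\<lambda>_. 1"]) auto

lemma C1_on_interval_add:
  assumes "C1_on_interval u v f" and "C1_on_interval u v g"
  shows "C1_on_interval u v (\<lambda>t. f t + g t)"
proof -
  obtain f' g' where "\<forall>t\<in>{u..v}. (f has_real_derivative f' t) (at t within {u..v})"
      "\<forall>t\<in>{u..v}. (g has_real_derivative g' t) (at t within {u..v})"
      "continuous_on {u..v} f'" "continuous_on {u..v} g'"
    using assms unfolding C1_on_interval_def by blast
  then show ?thesis unfolding C1_on_interval_def
    by (intro exI[of _ "\<lambda>t. f' t + g' t"]) (auto intro!: DERIV_add continuous_intros)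
qed

lemma C1_on_interval_mult:
  assumes "C1_on_interval u v f" and "C1_on_interval u v g"
  shows "C1_on_interval u v (\<lambda>t. f t * g t)"
proof -
  obtain f' g' where *: "\<forall>t\<in>{u..v}. (f has_real_derivative f' t) (at t within {u..v})"
      "\<forall>t\<in>{u..v}. (g has_real_derivative g' t) (at t within {u..v})"
      "continuous_on {u..v} f'" "continuous_on {u..v} g'"
    using assms unfolding C1_on_interval_def by blast
  note [continuous_intros] = assms[THEN C1_on_interval_continuous]
  show ?thesis unfolding C1_on_interval_def
    by (intro exI[of _ "\<lambda>t. f' t * g t + g' t * f t"])
      (use * in \<open>auto intro!: DERIV_mult continuous_intros\<close>)
qed

lemma C1_on_interval_diff:
  assumes "C1_on_interval u v f" and "C1_on_interval u v g"
  shows "C1_on_interval u v (\<lambda>t. f t - g t)"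
  using C1_on_interval_add[OF assms(1) C1_on_interval_mult[OF C1_on_interval_const[of u v "-1"] assms(2)]]
  by simp

lemma C1_on_interval_exp:
  assumes "C1_on_interval u v f"
  shows "C1_on_interval u v (\<lambda>t. exp (f t))"
proof -
  obtain f' where *: "\<forall>t\<in>{u..v}. (f has_real_derivative f' t) (at t within {u..v})"
      "continuous_on {u..v} f'"
    using assms unfolding C1_on_interval_def by blast
  note [continuous_intros] = C1_on_interval_continuous[OF assms]
  have "((\<lambda>t. exp (f t)) has_real_derivative exp (f t) * f' t) (at t within {u..v})"
    if "t \<in> {u..v}" for t
    by (rule DERIV_chain2[OF DERIV_exp *(1)[rule_format, OF that]])
  moreover have "continuous_on {u..v} (\<lambda>t. exp (f t) * f' t)"
    by (intro continuous_intros *(2))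
  ultimately show ?thesis unfolding C1_on_interval_def
    by (intro exI[of _ "\<lambda>t. exp (f t) * f' t"]) simp
qed

lemma C1_on_interval_reflect:
  assumes "C1_on_interval 0 T f"
  shows "C1_on_interval 0 T (\<lambda>t. f (T - t))"
proof -
  obtain f' where *: "\<forall>t\<in>{0..T}. (f has_real_derivative f' t) (at t within {0..T})"
      "continuous_on {0..T} f'"
    using assms unfolding C1_on_interval_def by blast
  have im: "(\<lambda>t. T - t) ` {0..T} = {0..T}" by simp
  have "((\<lambda>t. f (T - t)) has_real_derivative - f' (T - t)) (at t within {0..T})"
    if "t \<in> {0..T}" for t
  proof -
    have 1: "(f has_real_derivative f' (T - t)) (at (T - t) within (\<lambda>t. T - t) ` {0..T})"
      using *(1) that unfolding im by auto
    have 2: "((\<lambda>t. T - t) has_real_derivative -1) (at t within {0..T})"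
      by (auto intro!: derivative_eq_intros)
    show ?thesis using DERIV_image_chain[OF 1 2] by (simp add: o_def)
  qed
  moreover have "continuous_on {0..T} (\<lambda>t. - f' (T - t))"
    by (intro continuous_intros continuous_on_compose2[OF *(2)]) auto
  ultimately show ?thesis unfolding C1_on_interval_def
    by (intro exI[of _ "\<lambda>t. - f' (T - t)"]) simp
qed

section \<open>Integrals with a moving limit and Volterra integrals\<close>

lemma C1_on_interval_integral:
  assumes "continuous_on {0..T} f"
  shows "C1_on_interval 0 T (\<lambda>t. integral {0..t} f)"
  unfolding C1_on_interval_def
  by (intro exI[of _ f]) (use assms in \<open>auto intro: integral_has_real_derivative\<close>)

text \<open>The derivative of \<open>h\<close> is continued as a constant to the left of 0, and
  \<open>g\<close> is an antiderivative of the result. Differentiability at the gluing point 0 then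
  needs no case distinction. Both formulas for \<open>g\<close> hold because the difference of the
  two sides has derivative zero and vanishes at 0.\<close>

lemma C1_on_interval_extend:
  assumes "C1_on_interval 0 T h" and "0 \<le> T"
  obtains g d where
    "\<And>x. x \<in> {-T..T} \<Longrightarrow> (g has_real_derivative d x) (at x within {-T..T})"
    "continuous_on {-T..T} d"
    "\<And>x. x \<in> {0..T} \<Longrightarrow> g x = h x"
    "\<And>x. x \<in> {-T..0} \<Longrightarrow> g x = h 0 + d 0 * x"
proof -
  obtain h' where h': "\<And>t. t \<in> {0..T} \<Longrightarrow> (h has_real_derivative h' t) (at t within {0..T})"
      and cont: "continuous_on {0..T} h'"
    using assms unfolding C1_on_interval_def by blast
  define d where "d x = h' (max 0 x)" for x
  have d: "continuous_on {-T..T} d" unfolding d_def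
    using assms(2) by (intro continuous_on_compose2[OF cont] continuous_intros) auto
  obtain g0 where g0: "\<And>x. x \<in> {-T..T} \<Longrightarrow> (g0 has_vector_derivative d x) (at x within {-T..T})"
    using antiderivative_continuous[OF d] by blast
  define g where "g x = g0 x - g0 0 + h 0" for x
  have g: "(g has_real_derivative d x) (at x within {-T..T})" if "x \<in> {-T..T}" for x
    unfolding g_def using g0[OF that]
    by (auto intro!: derivative_eq_intros simp: has_real_derivative_iff_has_vector_derivative[symmetric])
  have right: "g x = h x" if x: "x \<in> {0..T}" for x
  proof -
    have "((\<lambda>x. g x - h x) has_real_derivative 0) (at y within {0..T})" if "y \<in> {0..T}" for y
      using DERIV_diff[OF DERIV_subset[OF g, of y "{0..T}"] h'[OF that]] that by (auto simp: d_def)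
    then obtain c where "\<And>y. y \<in> {0..T} \<Longrightarrow> g y - h y = c"
      using has_field_derivative_zero_constant[of "{0..T}" "\<lambda>x. g x - h x"] by auto
    from this[OF x] this[of 0] have "g x - h x = g 0 - h 0" using assms(2) by simp
    then show ?thesis by (simp add: g_def)
  qed
  have left: "g x = h 0 + d 0 * x" if x: "x \<in> {-T..0}" for x
  proof -
    have "((\<lambda>x. g x - d 0 * x) has_real_derivative 0) (at y within {-T..0})" if "y \<in> {-T..0}" for y
    proof -
      have "(g has_real_derivative d 0) (at y within {-T..0})"
        using DERIV_subset[OF g, of y "{-T..0}"] that assms(2) by (auto simp: d_def max_def split: if_splits)
      then show ?thesis by (auto intro!: derivative_eq_intros)
    qed
    then obtain c where "\<And>y. y \<in> {-T..0} \<Longrightarrow> g y - d 0 * y = c"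
      using has_field_derivative_zero_constant[of "{-T..0}" "\<lambda>x. g x - d 0 * x"] by auto
    from this[OF x] this[of 0] have "g x - d 0 * x = g 0 - d 0 * 0" using assms(2) by simp
    then show ?thesis by (simp add: g_def)
  qed
  show thesis by (rule that[OF g d right left])
qed

text \<open>
  The variable lower limit is traded for the fixed interval \<open>{0..T}\<close> by continuing \<open>h\<close> affinely to
  negative arguments; the part added is then explicit.
\<close>
lemma C1_on_interval_volterra:
  assumes h: "C1_on_interval 0 T h" and T: "0 \<le> T" and f: "continuous_on {0..T} f"
  shows "C1_on_interval 0 T (\<lambda>t. integral {t..T} (\<lambda>s. h (s - t) * f s))"
proof -
  obtain g d where
    g: "\<And>x. x \<in> {-T..T} \<Longrightarrow> (g has_real_derivative d x) (at x within {-T..T})"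
    and d: "continuous_on {-T..T} d"
    and right: "\<And>x. x \<in> {0..T} \<Longrightarrow> g x = h x"
    and left: "\<And>x. x \<in> {-T..0} \<Longrightarrow> g x = h 0 + d 0 * x"
    using C1_on_interval_extend[OF h T] by blast
  have gc: "continuous_on {-T..T} g"
    using g by (meson DERIV_continuous continuous_on_eq_continuous_within)
  define dF where "dF t = integral {0..T} (\<lambda>s. - d (s - t) * f s)" for t
  have c2: "continuous_on ({0..T} \<times> cbox 0 T) (\<lambda>(t, s). - d (s - t) * f s)"
    unfolding split_beta
    by (intro continuous_intros continuous_on_compose2[OF d] continuous_on_compose2[OF f]) auto
  \<comment> \<open>With \<open>g\<close> in place of \<open>h\<close> the domain of integration is
    fixed, so one may differentiate under the integral sign. The argument \<open>s - t\<close> now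
    runs through all of \<open>{-T..T}\<close>.\<close>
  have "((\<lambda>t. integral (cbox 0 T) (\<lambda>s. g (s - t) * f s)) has_real_derivative
      integral (cbox 0 T) (\<lambda>s. - d (s - t) * f s)) (at t within {0..T})" if "t \<in> {0..T}" for t
  proof (rule leibniz_rule_field_derivative[OF _ _ c2 that])
    fix t s assume ts: "t \<in> {0..T}" "s \<in> cbox 0 T"
    have 1: "(g has_real_derivative d (s - t)) (at (s - t) within (\<lambda>t. s - t) ` {0..T})"
      by (rule DERIV_subset[OF g]) (use ts in auto)
    have 2: "((\<lambda>t. s - t) has_real_derivative -1) (at t within {0..T})"
      by (auto intro!: derivative_eq_intros)
    have "((\<lambda>t. g (s - t)) has_real_derivative - d (s - t)) (at t within {0..T})"
      using DERIV_image_chain[OF 1 2] by (simp add: o_def)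
    then show "((\<lambda>t. g (s - t) * f s) has_real_derivative - d (s - t) * f s) (at t within {0..T})"
      by (auto intro!: derivative_eq_intros)
  next
    fix t assume "t \<in> {0..T}"
    then show "(\<lambda>s. g (s - t) * f s) integrable_on cbox 0 T"
      by (intro integrable_continuous continuous_intros continuous_on_compose2[OF gc]
          continuous_on_compose2[OF f]) auto
  qed auto
  moreover have "continuous_on {0..T} dF"
    unfolding dF_def using integral_continuous_on_param[OF c2] by simp
  ultimately have 1: "C1_on_interval 0 T (\<lambda>t. integral {0..T} (\<lambda>s. g (s - t) * f s))"
    unfolding C1_on_interval_def dF_def by (intro exI[of _ dF]) (auto simp: dF_def)
  have sf: "continuous_on {0..T} (\<lambda>s. s * f s)" by (intro continuous_intros f)
  \<comment> \<open>This is the surplus integral over \<open>{0..t}\<close>. There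
    \<open>s - t\<close> is nonpositive, so \<open>g (s - t)\<close> equals
    \<open>h 0 - d 0 * t + d 0 * s\<close> and the variable \<open>t\<close> can be taken out of the
    integral.\<close>
  have 2: "C1_on_interval 0 T (\<lambda>t. (h 0 - d 0 * t) * integral {0..t} f
      + d 0 * integral {0..t} (\<lambda>s. s * f s))"
    by (intro C1_on_interval_add C1_on_interval_mult C1_on_interval_diff C1_on_interval_const
        C1_on_interval_ident C1_on_interval_integral f sf)
  show ?thesis
  proof (rule C1_on_interval_cong[OF C1_on_interval_diff[OF 1 2]])
    fix t assume t: "t \<in> {0..T}"
    have int: "(\<lambda>s. g (s - t) * f s) integrable_on {0..T}"
      using t by (intro integrable_continuous_interval continuous_intros continuous_on_compose2[OF gc]
          continuous_on_compose2[OF f]) auto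
    have int0: "f integrable_on {0..t}" "(\<lambda>s. s * f s) integrable_on {0..t}"
      using t continuous_on_subset[OF f] continuous_on_subset[OF sf]
      by (auto intro!: integrable_continuous_interval)
    have "integral {0..t} (\<lambda>s. g (s - t) * f s)
        = integral {0..t} (\<lambda>s. (h 0 - d 0 * t) * f s + d 0 * (s * f s))"
      by (rule integral_cong) (use t left in \<open>auto simp: algebra_simps\<close>)
    also have "\<dots> = (h 0 - d 0 * t) * integral {0..t} f + d 0 * integral {0..t} (\<lambda>s. s * f s)"
      using int0 by (subst integral_add) (auto intro: integrable_on_mult_right)
    finally have "integral {0..t} (\<lambda>s. g (s - t) * f s)
      = (h 0 - d 0 * t) * integral {0..t} f + d 0 * integral {0..t} (\<lambda>s. s * f s)" .
    moreover have "integral {t..T} (\<lambda>s. g (s - t) * f s) = integral {t..T} (\<lambda>s. h (s - t) * f s)"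
      by (rule integral_cong) (use t right in auto)
    ultimately show "integral {0..T} (\<lambda>s. g (s - t) * f s) -
         ((h 0 - d 0 * t) * integral {0..t} f + d 0 * integral {0..t} (\<lambda>s. s * f s)) =
         integral {t..T} (\<lambda>s. h (s - t) * f s)"
      using Henstock_Kurzweil_Integration.integral_combine[OF _ _ int, of t] t by auto
  qed
qed


section \<open>Lipschitz estimates for powers and the exponential\<close>

text \<open>Mean value estimate: for \<open>r \<le> 1\<close> the derivative
  \<open>r * z powr (r - 1)\<close> is at most \<open>\<bar>r\<bar>\<close> in absolute value on
  \<open>{1..}\<close>. This is why the argument keeps all functions above 1.\<close>

lemma powr_lipschitz_ge_1:
  fixes x y r :: real
  assumes "1 \<le> x" "1 \<le> y" "r \<le> 1"
  shows "\<bar>x powr r - y powr r\<bar> \<le> \<bar>r\<bar> * \<bar>x - y\<bar>"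
proof -
  have "norm (x powr r - y powr r) \<le> \<bar>r\<bar> * norm (x - y)"
  proof (rule field_differentiable_bound[of "{1..}" "\<lambda>x. x powr r" "\<lambda>x. r * x powr (r - 1)"])
    fix z :: real assume z: "z \<in> {1..}"
    then show "((\<lambda>x. x powr r) has_real_derivative r * z powr (r - 1)) (at z within {1..})"
      by (auto intro!: derivative_eq_intros simp: powr_diff)
    have "z powr (r - 1) \<le> z powr 0" using z assms by (intro powr_mono) auto
    then show "norm (r * z powr (r - 1)) \<le> \<bar>r\<bar>"
      using z by (auto simp: abs_mult mult_left_le)
  qed (use assms in auto)
  then show ?thesis by simp
qed

lemma exp_lipschitz_le_0:
  fixes x y :: real
  assumes "x \<le> 0" "y \<le> 0"
  shows "\<bar>exp x - exp y\<bar> \<le> \<bar>x - y\<bar>"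
proof -
  have "norm (exp x - exp y) \<le> 1 * norm (x - y)"
    by (rule field_differentiable_bound[of "{..0}" exp exp])
      (use assms in \<open>auto intro!: derivative_eq_intros\<close>)
  then show ?thesis by simp
qed

section \<open>The right-hand side of the equation as an operator\<close>

text \<open>
  The constant \<open>K\<close> is taken equal to \<open>\<gamma>\<close>, which makes the exponent nonpositive when \<open>\<gamma> < 0\<close> and
  \<open>a \<ge> 1\<close>.
\<close>
definition growth_factor :: "real \<Rightarrow> (real \<Rightarrow> real) \<Rightarrow> real \<Rightarrow> real \<Rightarrow> real" where
  "growth_factor \<gamma> a t s = exp (\<gamma> * (s - t) - \<gamma> * integral {t..s} (\<lambda>z. a z powr (1 / (\<gamma> - 1))))"

definition equilibrium_map ::
  "(real \<Rightarrow> real) \<Rightarrow> real \<Rightarrow> real \<Rightarrow> real \<Rightarrow> (real \<Rightarrow> real) \<Rightarrow> real \<Rightarrow> real" where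
  "equilibrium_map h T n \<gamma> a t =
     integral {t..T} (\<lambda>s. h (s - t) * a s powr (\<gamma> / (\<gamma> - 1)) * growth_factor \<gamma> a t s)
     + n * h (T - t) * growth_factor \<gamma> a t T"

text \<open>The last three groups of assumptions serve the fixed point argument:
  \<open>lower\<close> makes the terminal term alone at least 1, \<open>upper\<close> keeps the
  image of functions with values in \<open>{1..M}\<close> below \<open>M\<close>, and
  \<open>contraction\<close> bounds the Lipschitz constant in the supremum norm. All of these bind
  only through the size of \<open>\<gamma>\<close>.\<close>

locale near_log_merton =
  fixes h :: "real \<Rightarrow> real" and T n \<gamma> M :: real
  assumes T_pos: "0 < T" and n_pos: "0 < n" and \<gamma>_neg: "\<gamma> < 0"
    and h_C1: "C1_on_interval 0 T h" and h_0: "h 0 = 1"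
    and h_le_1: "\<And>t. t \<in> {0..T} \<Longrightarrow> h t \<le> 1"
    and h_ge: "\<And>t. t \<in> {0..T} \<Longrightarrow> h T \<le> h t"
    and lower: "1 \<le> n * h T * exp (\<gamma> * T)"
    and M_ge_1: "1 \<le> M" and upper: "T + n \<le> M * (1 + \<gamma> * T)"
    and contraction: "- \<gamma> * (T * (1 + (1 - \<gamma> * M) * T) + n * T) < 1"
begin

abbreviation p where "p \<equiv> \<gamma> / (\<gamma> - 1)"
abbreviation q where "q \<equiv> 1 / (\<gamma> - 1)"
abbreviation \<Phi> where "\<Phi> \<equiv> equilibrium_map h T n \<gamma>"
abbreviation E where "E \<equiv> growth_factor \<gamma>"

lemma p_bounds: "0 \<le> p" "\<bar>p\<bar> \<le> - \<gamma>" "p \<le> 1"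
  and q_bounds: "q \<le> 0" "\<bar>q\<bar> \<le> 1" "q \<le> 1"
  using \<gamma>_neg by (auto simp: field_simps)

lemma h_cont: "continuous_on {0..T} h"
  by (rule C1_on_interval_continuous[OF h_C1])

lemma h_T_pos: "0 < h T"
proof -
  have "0 < n * h T * exp (\<gamma> * T)" using lower by linarith
  then show ?thesis using n_pos by (simp add: zero_less_mult_iff)
qed

lemma h_nonneg: "t \<in> {0..T} \<Longrightarrow> 0 \<le> h t"
  using h_ge[of t] h_T_pos by linarith

lemma powr_cont:
  fixes a :: "real \<Rightarrow> real" and r :: real
  assumes "continuous_on {0..T} a" "\<And>t. t \<in> {0..T} \<Longrightarrow> 0 < a t"
  shows "continuous_on {0..T} (\<lambda>t. a t powr r)"
  by (intro continuous_on_powr continuous_on_const assms(1)) (use assms(2) in force)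

lemma powr_int:
  fixes a :: "real \<Rightarrow> real" and r :: real
  assumes "continuous_on {0..T} a" "\<And>t. t \<in> {0..T} \<Longrightarrow> 0 < a t" "0 \<le> t" "s \<le> T"
  shows "(\<lambda>t. a t powr r) integrable_on {t..s}"
  by (rule integrable_continuous_interval, rule continuous_on_subset[OF powr_cont[OF assms(1,2)]])
    (use assms in auto)

lemma E_cont:
  assumes "continuous_on {0..T} a" "\<And>t. t \<in> {0..T} \<Longrightarrow> 0 < a t" "0 \<le> t"
  shows "continuous_on {t..T} (E a t)"
  unfolding growth_factor_def
  by (intro continuous_intros indefinite_integral_continuous_1 powr_int assms) auto

lemma h_shift_cont: "0 \<le> t \<Longrightarrow> continuous_on {t..T} (\<lambda>s. h (s - t))"
  by (intro continuous_on_compose2[OF h_cont] continuous_intros) auto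

lemma integrand_int:
  assumes "continuous_on {0..T} a" "\<And>t. t \<in> {0..T} \<Longrightarrow> 0 < a t" "0 \<le> t"
  shows "(\<lambda>s. h (s - t) * a s powr p * E a t s) integrable_on {t..T}"
  by (intro integrable_continuous_interval continuous_on_mult h_shift_cont E_cont
      continuous_on_subset[OF powr_cont[OF assms(1,2)]]) (use assms in auto)

text \<open>The growth factor splits as \<open>exp (W s) * exp (- W t)\<close>, since its exponent
  is an increment of \<open>W\<close>. What remains under the integral is a kernel in
  \<open>s - t\<close> times a fixed continuous function, as in
  \<open>C1_on_interval_volterra\<close>. Continuity of \<open>a\<close> therefore suffices for a C1
  image.\<close>

lemma equilibrium_map_C1:
  assumes "continuous_on {0..T} a" "\<And>t. t \<in> {0..T} \<Longrightarrow> 0 < a t"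
  shows "C1_on_interval 0 T (\<Phi> a)"
proof -
  define W where "W t = \<gamma> * t - \<gamma> * integral {0..t} (\<lambda>z. a z powr q)" for t
  have W: "C1_on_interval 0 T W" unfolding W_def
    by (intro C1_on_interval_diff C1_on_interval_mult C1_on_interval_const C1_on_interval_ident
        C1_on_interval_integral powr_cont assms)
  have f: "continuous_on {0..T} (\<lambda>s. a s powr p * exp (W s))"
    by (intro continuous_intros powr_cont assms C1_on_interval_continuous[OF W])
  have C1: "C1_on_interval 0 T (\<lambda>t. exp (0 - W t) *
      (integral {t..T} (\<lambda>s. h (s - t) * (a s powr p * exp (W s))) + (n * exp (W T)) * h (T - t)))"
    by (intro C1_on_interval_mult C1_on_interval_add C1_on_interval_diff C1_on_interval_exp
        C1_on_interval_const C1_on_interval_volterra C1_on_interval_reflect W h_C1 f)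
      (use T_pos in auto)
  show ?thesis
  proof (rule C1_on_interval_cong[OF C1])
    fix t assume t: "t \<in> {0..T}"
    have E: "E a t s = exp (W s) * exp (- W t)" if "s \<in> {t..T}" for s
    proof -
      have "integral {0..t} (\<lambda>z. a z powr q) + integral {t..s} (\<lambda>z. a z powr q)
          = integral {0..s} (\<lambda>z. a z powr q)"
        by (rule Henstock_Kurzweil_Integration.integral_combine)
          (use t that in \<open>auto intro!: powr_int assms\<close>)
      then have I: "integral {t..s} (\<lambda>z. a z powr q)
          = integral {0..s} (\<lambda>z. a z powr q) - integral {0..t} (\<lambda>z. a z powr q)" by simp
      show ?thesis
        unfolding growth_factor_def W_def I by (simp add: algebra_simps flip: exp_add)
    qed
    have "integral {t..T} (\<lambda>s. h (s - t) * a s powr p * E a t s)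
        = integral {t..T} (\<lambda>s. exp (- W t) * (h (s - t) * (a s powr p * exp (W s))))"
      by (rule integral_cong) (simp add: E)
    also have "\<dots> = exp (- W t) * integral {t..T} (\<lambda>s. h (s - t) * (a s powr p * exp (W s)))"
      by simp
    finally show "exp (0 - W t) *
      (integral {t..T} (\<lambda>s. h (s - t) * (a s powr p * exp (W s))) + (n * exp (W T)) * h (T - t))
      = \<Phi> a t"
      using t by (simp add: equilibrium_map_def E algebra_simps)
  qed
qed

section \<open>Bounds and Lipschitz constant of the operator\<close>

lemma E_ge:
  assumes "0 \<le> t" "t \<le> s" "s \<le> T"
  shows "exp (\<gamma> * T) \<le> E a t s"
proof -
  have "0 \<le> integral {t..s} (\<lambda>z. a z powr q)"
    \<comment> \<open>A function that is not integrable has integral 0 by convention, so nothing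
      need be assumed about \<open>a\<close>.\<close>
    by (cases "(\<lambda>z. a z powr q) integrable_on {t..s}")
      (auto intro: integral_nonneg simp: not_integrable_integral)
  then have "0 \<le> - \<gamma> * integral {t..s} (\<lambda>z. a z powr q)"
    using \<gamma>_neg by (intro mult_nonneg_nonneg) auto
  moreover have "\<gamma> * T \<le> \<gamma> * (s - t)" using \<gamma>_neg assms by (intro mult_left_mono_neg) auto
  ultimately show ?thesis by (simp add: growth_factor_def)
qed

text \<open>As \<open>q \<le> 0\<close> and \<open>a \<ge> 1\<close>, the integrand is at most 1 and
  its integral at most \<open>s - t\<close>; multiplying by the negative \<open>\<gamma>\<close>
  gives the sign. It puts the exponent where the exponential is 1-Lipschitz.\<close>

lemma E_exponent_le_0:
  assumes "continuous_on {0..T} a" "\<And>t. t \<in> {0..T} \<Longrightarrow> 1 \<le> a t" "0 \<le> t" "t \<le> s" "s \<le> T"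
  shows "\<gamma> * (s - t) - \<gamma> * integral {t..s} (\<lambda>z. a z powr q) \<le> 0"
proof -
  have pos: "\<And>t. t \<in> {0..T} \<Longrightarrow> 0 < a t" using assms(2) by fastforce
  have "integral {t..s} (\<lambda>z. a z powr q) \<le> integral {t..s} (\<lambda>z. 1)"
  proof (rule integral_le)
    fix z assume "z \<in> {t..s}"
    then have "1 \<le> a z" using assms by auto
    then show "a z powr q \<le> 1" using powr_mono[of q 0 "a z"] q_bounds by simp
  qed (use powr_int[OF assms(1) pos] assms in auto)
  then have "integral {t..s} (\<lambda>z. a z powr q) \<le> s - t" using assms by simp
  then show ?thesis using \<gamma>_neg by simp
qed

lemma E_le_1:
  assumes "continuous_on {0..T} a" "\<And>t. t \<in> {0..T} \<Longrightarrow> 1 \<le> a t" "0 \<le> t" "t \<le> s" "s \<le> T"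
  shows "E a t s \<le> 1"
  using E_exponent_le_0[OF assms] by (simp add: growth_factor_def)

text \<open>Both the power with exponent \<open>q\<close> on \<open>{1..}\<close> and the
  exponential on nonpositive reals are 1-Lipschitz, so the smallness comes entirely from the factor
  \<open>- \<gamma>\<close> in the exponent.\<close>

lemma E_diff:
  assumes a: "continuous_on {0..T} a" "\<And>t. t \<in> {0..T} \<Longrightarrow> 1 \<le> a t"
    and b: "continuous_on {0..T} b" "\<And>t. t \<in> {0..T} \<Longrightarrow> 1 \<le> b t"
    and d: "\<And>t. t \<in> {0..T} \<Longrightarrow> \<bar>a t - b t\<bar> \<le> d"
    and ts: "0 \<le> t" "t \<le> s" "s \<le> T"
  shows "\<bar>E a t s - E b t s\<bar> \<le> - \<gamma> * (T * d)"
proof -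
  let ?I = "\<lambda>a. integral {t..s} (\<lambda>z. a z powr q)"
  have pos: "\<And>t. t \<in> {0..T} \<Longrightarrow> 0 < a t" "\<And>t. t \<in> {0..T} \<Longrightarrow> 0 < b t"
    using a(2) b(2) by fastforce+
  have int: "(\<lambda>z. a z powr q) integrable_on {t..s}" "(\<lambda>z. b z powr q) integrable_on {t..s}"
    using powr_int[OF a(1) pos(1)] powr_int[OF b(1) pos(2)] ts by auto
  have d0: "0 \<le> d" using d[of 0] T_pos by (auto intro: order_trans)
  have "norm (integral {t..s} (\<lambda>z. a z powr q - b z powr q)) \<le> integral {t..s} (\<lambda>z. d)"
  proof (rule integral_norm_bound_integral)
    fix z assume z: "z \<in> {t..s}"
    have "\<bar>a z powr q - b z powr q\<bar> \<le> \<bar>q\<bar> * \<bar>a z - b z\<bar>"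
      using a b z ts by (intro powr_lipschitz_ge_1 q_bounds) auto
    also have "\<dots> \<le> 1 * d" using d z ts by (intro mult_mono q_bounds) auto
    finally show "norm (a z powr q - b z powr q) \<le> d" by simp
  qed (use int in \<open>auto intro: integrable_diff\<close>)
  then have "\<bar>?I a - ?I b\<bar> \<le> (s - t) * d" using ts int by (simp add: integral_diff)
  also have "\<dots> \<le> T * d" using ts d0 by (intro mult_right_mono) auto
  finally have I: "\<bar>?I a - ?I b\<bar> \<le> T * d" .
  have "\<bar>E a t s - E b t s\<bar>
      \<le> \<bar>(\<gamma> * (s - t) - \<gamma> * ?I a) - (\<gamma> * (s - t) - \<gamma> * ?I b)\<bar>"
    unfolding growth_factor_def
    by (intro exp_lipschitz_le_0 E_exponent_le_0 a b ts)
  also have "\<dots> = - \<gamma> * \<bar>?I a - ?I b\<bar>"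
    using \<gamma>_neg by (simp add: abs_mult flip: right_diff_distrib)
  also have "\<dots> \<le> - \<gamma> * (T * d)" using I \<gamma>_neg by (intro mult_left_mono) auto
  finally show ?thesis .
qed

lemma powr_p_le:
  assumes "1 \<le> x" "x \<le> B"
  shows "x powr p \<le> 1 - \<gamma> * B"
proof -
  have "\<bar>x powr p - 1 powr p\<bar> \<le> \<bar>p\<bar> * \<bar>x - 1\<bar>"
    using assms by (intro powr_lipschitz_ge_1 p_bounds) auto
  also have "\<dots> \<le> - \<gamma> * B" using \<gamma>_neg assms by (intro mult_mono p_bounds) auto
  finally show ?thesis by simp
qed

text \<open>The right-hand side of the equation at \<open>\<gamma> = 0\<close>.\<close>
definition log_limit where
  "log_limit t = integral {t..T} (\<lambda>s. h (s - t)) + n * h (T - t)"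

lemma log_limit_le: "t \<in> {0..T} \<Longrightarrow> log_limit t \<le> T + n"
proof -
  assume t: "t \<in> {0..T}"
  have "integral {t..T} (\<lambda>s. h (s - t)) \<le> integral {t..T} (\<lambda>s. 1)"
    using t h_shift_cont by (intro integral_le integrable_continuous_interval h_le_1) auto
  moreover have "n * h (T - t) \<le> n * 1" using t n_pos h_le_1 by (intro mult_left_mono) auto
  ultimately show ?thesis using t by (auto simp: log_limit_def)
qed

text \<open>Since \<open>h\<close> and \<open>E\<close> are at most 1, the excess over the limit
  comes only from the power of \<open>a\<close>, which is at most \<open>1 - \<gamma> * B\<close>.
  The bound \<open>B\<close> is left free: it is the maximum of \<open>a\<close> in the a priori
  estimate and \<open>M\<close> in the fixed point argument.\<close>

lemma equilibrium_map_le: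
  assumes a: "continuous_on {0..T} a" "\<And>t. t \<in> {0..T} \<Longrightarrow> 1 \<le> a t"
    and B: "\<And>t. t \<in> {0..T} \<Longrightarrow> a t \<le> B" and t: "t \<in> {0..T}"
  shows "\<Phi> a t \<le> log_limit t - \<gamma> * T * B"
proof -
  have pos: "\<And>t. t \<in> {0..T} \<Longrightarrow> 0 < a t" using a(2) by fastforce
  have "1 \<le> B" using a(2)[OF t] B[OF t] by linarith
  then have \<gamma>B: "0 \<le> - \<gamma> * B" using \<gamma>_neg by (intro mult_nonneg_nonneg) auto
  have "integral {t..T} (\<lambda>s. h (s - t) * a s powr p * E a t s)
      \<le> integral {t..T} (\<lambda>s. h (s - t) + - \<gamma> * B)"
  proof (rule integral_le)
    fix s assume s: "s \<in> {t..T}"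
    have "h (s - t) * a s powr p * E a t s \<le> h (s - t) * (1 - \<gamma> * B) * 1"
      using s t h_nonneg \<gamma>B
      by (intro mult_mono powr_p_le E_le_1 a B mult_nonneg_nonneg) (auto simp: growth_factor_def)
    also have "\<dots> = h (s - t) + h (s - t) * (- \<gamma> * B)" by (simp add: algebra_simps)
    also have "\<dots> \<le> h (s - t) + 1 * (- \<gamma> * B)"
      using s t \<gamma>B h_le_1 by (intro add_left_mono mult_right_mono) auto
    finally show "h (s - t) * a s powr p * E a t s \<le> h (s - t) + - \<gamma> * B" by simp
  qed (use t integrand_int[OF a(1) pos] h_shift_cont in
      \<open>auto intro!: integrable_continuous_interval continuous_intros\<close>)
  also have "\<dots> = integral {t..T} (\<lambda>s. h (s - t)) + (T - t) * (- \<gamma> * B)"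
    using t h_shift_cont by (subst integral_add) (auto intro: integrable_continuous_interval)
  also have "\<dots> \<le> integral {t..T} (\<lambda>s. h (s - t)) + T * (- \<gamma> * B)"
    using t \<gamma>B by (intro add_left_mono mult_right_mono) auto
  finally have "integral {t..T} (\<lambda>s. h (s - t) * a s powr p * E a t s)
      \<le> integral {t..T} (\<lambda>s. h (s - t)) - \<gamma> * T * B" by (simp add: algebra_simps)
  moreover have "n * h (T - t) * E a t T \<le> n * h (T - t) * 1"
    using t n_pos h_nonneg by (intro mult_left_mono E_le_1 a) auto
  ultimately show ?thesis by (simp add: equilibrium_map_def log_limit_def)
qed

lemma equilibrium_map_ge:
  assumes a: "continuous_on {0..T} a" "\<And>t. t \<in> {0..T} \<Longrightarrow> 1 \<le> a t" and t: "t \<in> {0..T}"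
  shows "exp (\<gamma> * T) * log_limit t \<le> \<Phi> a t"
proof -
  have pos: "\<And>t. t \<in> {0..T} \<Longrightarrow> 0 < a t" using a(2) by fastforce
  have "integral {t..T} (\<lambda>s. exp (\<gamma> * T) * h (s - t))
      \<le> integral {t..T} (\<lambda>s. h (s - t) * a s powr p * E a t s)"
  proof (rule integral_le)
    fix s assume s: "s \<in> {t..T}"
    have "1 powr p \<le> a s powr p" using a s t by (intro powr_mono2 p_bounds) auto
    then have "1 * exp (\<gamma> * T) \<le> a s powr p * E a t s"
      by (intro mult_mono E_ge) (use s t in auto)
    then have "h (s - t) * (1 * exp (\<gamma> * T)) \<le> h (s - t) * (a s powr p * E a t s)"
      by (intro mult_left_mono) (use s t h_nonneg in auto)
    then show "exp (\<gamma> * T) * h (s - t) \<le> h (s - t) * a s powr p * E a t s"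
      by (simp add: mult_ac)
  qed (use t integrand_int[OF a(1) pos] h_shift_cont in
      \<open>auto intro!: integrable_continuous_interval continuous_intros\<close>)
  moreover have "n * h (T - t) * exp (\<gamma> * T) \<le> n * h (T - t) * E a t T"
    using t n_pos h_nonneg by (intro mult_left_mono E_ge) auto
  ultimately show ?thesis by (simp add: equilibrium_map_def log_limit_def algebra_simps)
qed

text \<open>The integral is nonnegative and the terminal term is already at least 1 by
  \<open>lower\<close>. Only positivity of \<open>a\<close> enters, so the bound is available for an
  arbitrary solution.\<close>

lemma equilibrium_map_ge_1:
  assumes a: "continuous_on {0..T} a" "\<And>t. t \<in> {0..T} \<Longrightarrow> 0 < a t" and t: "t \<in> {0..T}"
  shows "1 \<le> \<Phi> a t"
proof -
  have "n * h T * exp (\<gamma> * T) \<le> n * h (T - t) * E a t T"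
    using t n_pos h_nonneg h_ge T_pos by (intro mult_mono E_ge mult_nonneg_nonneg) auto
  moreover have "0 \<le> integral {t..T} (\<lambda>s. h (s - t) * a s powr p * E a t s)"
    using t integrand_int[OF a] h_nonneg by (intro integral_nonneg) (auto simp: growth_factor_def)
  ultimately show ?thesis using lower by (simp add: equilibrium_map_def)
qed

lemma equilibrium_map_diff:
  assumes a: "continuous_on {0..T} a" "\<And>t. t \<in> {0..T} \<Longrightarrow> 1 \<le> a t" "\<And>t. t \<in> {0..T} \<Longrightarrow> a t \<le> M"
    and b: "continuous_on {0..T} b" "\<And>t. t \<in> {0..T} \<Longrightarrow> 1 \<le> b t" "\<And>t. t \<in> {0..T} \<Longrightarrow> b t \<le> M"
    and d: "\<And>t. t \<in> {0..T} \<Longrightarrow> \<bar>a t - b t\<bar> \<le> d" and t: "t \<in> {0..T}"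
  shows "\<bar>\<Phi> a t - \<Phi> b t\<bar> \<le> - \<gamma> * (T * (1 + (1 - \<gamma> * M) * T) + n * T) * d"
proof -
  have pos: "\<And>t. t \<in> {0..T} \<Longrightarrow> 0 < a t" "\<And>t. t \<in> {0..T} \<Longrightarrow> 0 < b t"
    using a(2) b(2) by fastforce+
  have d0: "0 \<le> d" using d[of 0] T_pos by (auto intro: order_trans)
  have "0 \<le> - \<gamma> * M" using \<gamma>_neg M_ge_1 by (intro mult_nonneg_nonneg) auto
  then have \<gamma>M: "0 \<le> 1 - \<gamma> * M" by simp
  let ?C = "- \<gamma> * d + (1 - \<gamma> * M) * (- \<gamma> * (T * d))"
  have C0: "0 \<le> ?C" using \<gamma>_neg d0 T_pos \<gamma>M by (intro add_nonneg_nonneg mult_nonneg_nonneg) auto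
  let ?f = "\<lambda>a s. h (s - t) * a s powr p * E a t s"
  have int: "?f a integrable_on {t..T}" "?f b integrable_on {t..T}"
    using t integrand_int[OF a(1) pos(1)] integrand_int[OF b(1) pos(2)] by auto
  have "norm (integral {t..T} (\<lambda>s. ?f a s - ?f b s)) \<le> integral {t..T} (\<lambda>s. ?C)"
  proof (rule integral_norm_bound_integral)
    fix s assume s: "s \<in> {t..T}"
    have "\<bar>a s powr p - b s powr p\<bar> \<le> \<bar>p\<bar> * \<bar>a s - b s\<bar>"
      using a b s t by (intro powr_lipschitz_ge_1 p_bounds) auto
    also have "\<dots> \<le> - \<gamma> * d" using d s t \<gamma>_neg by (intro mult_mono p_bounds) auto
    finally have 1: "\<bar>a s powr p - b s powr p\<bar> \<le> - \<gamma> * d" .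
    \<comment> \<open>The difference of products is split by inserting
      \<open>b s powr p * E a t s\<close>, so that each factor varies alone.\<close>
    have "\<bar>a s powr p * E a t s - b s powr p * E b t s\<bar>
        = \<bar>(a s powr p - b s powr p) * E a t s + b s powr p * (E a t s - E b t s)\<bar>"
      by (simp add: algebra_simps)
    also have "\<dots> \<le> \<bar>a s powr p - b s powr p\<bar> * E a t s + b s powr p * \<bar>E a t s - E b t s\<bar>"
      by (rule order_trans[OF abs_triangle_ineq]) (simp add: abs_mult growth_factor_def)
    also have "\<dots> \<le> (- \<gamma> * d) * 1 + (1 - \<gamma> * M) * (- \<gamma> * (T * d))"
      by (intro add_mono mult_mono 1 E_le_1 powr_p_le E_diff a b d)
        (use s t \<gamma>M \<gamma>_neg d0 in \<open>auto simp: growth_factor_def mult_nonpos_nonneg\<close>)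
    finally have "\<bar>a s powr p * E a t s - b s powr p * E b t s\<bar> \<le> ?C" by simp
    then have "h (s - t) * \<bar>a s powr p * E a t s - b s powr p * E b t s\<bar> \<le> 1 * ?C"
      using s t h_nonneg h_le_1 C0 by (intro mult_mono) auto
    moreover have "norm (?f a s - ?f b s)
        = h (s - t) * \<bar>a s powr p * E a t s - b s powr p * E b t s\<bar>"
      using s t h_nonneg[of "s - t"]
      by (simp add: mult.assoc abs_mult flip: right_diff_distrib)
    ultimately show "norm (?f a s - ?f b s) \<le> ?C" by simp
  qed (use int in \<open>auto intro: integrable_diff\<close>)
  then have "\<bar>integral {t..T} (?f a) - integral {t..T} (?f b)\<bar> \<le> (T - t) * ?C"
    using t int by (simp add: integral_diff)
  also have "\<dots> \<le> T * ?C" using t C0 by (intro mult_right_mono) auto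
  finally have I: "\<bar>integral {t..T} (?f a) - integral {t..T} (?f b)\<bar> \<le> T * ?C" .
  have "n * h (T - t) * \<bar>E a t T - E b t T\<bar> \<le> n * 1 * (- \<gamma> * (T * d))"
    by (intro mult_mono E_diff a b d) (use t n_pos h_nonneg h_le_1 in auto)
  moreover have "\<bar>n * h (T - t) * E a t T - n * h (T - t) * E b t T\<bar>
      = n * h (T - t) * \<bar>E a t T - E b t T\<bar>"
    using t n_pos h_nonneg[of "T - t"] by (simp add: abs_mult flip: right_diff_distrib)
  ultimately have "\<bar>\<Phi> a t - \<Phi> b t\<bar> \<le> T * ?C + n * 1 * (- \<gamma> * (T * d))"
    using I unfolding equilibrium_map_def by linarith
  then show ?thesis by (simp add: algebra_simps)
qed


section \<open>Existence, uniqueness and location of the solution\<close>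

text \<open>Links the problem to the contraction. From left to right it is an a priori estimate,
  which makes uniqueness hold among all positive C1 solutions; from right to left, the C1 property
  and the terminal condition follow from the fixed point equation.\<close>

lemma equilibrium_solution_iff:
  "equilibrium_solution h \<gamma> T n \<gamma> a \<longleftrightarrow>
    continuous_on {0..T} a \<and> (\<forall>t\<in>{0..T}. a t \<in> {1..M}) \<and> (\<forall>t\<in>{0..T}. a t = \<Phi> a t)"
    (is "?sol \<longleftrightarrow> ?fix")
proof
  assume sol: ?sol
  then have cont: "continuous_on {0..T} a" and pos: "\<And>t. t \<in> {0..T} \<Longrightarrow> 0 < a t"
    and fixed: "\<And>t. t \<in> {0..T} \<Longrightarrow> a t = \<Phi> a t"
    unfolding equilibrium_solution_def equilibrium_map_def growth_factor_def
    by (blast intro: C1_on_interval_continuous)+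
  have ge: "1 \<le> a t" if "t \<in> {0..T}" for t
    using equilibrium_map_ge_1[OF cont pos that] fixed[OF that] by simp
  obtain t0 where t0: "t0 \<in> {0..T}" "\<And>t. t \<in> {0..T} \<Longrightarrow> a t \<le> a t0"
    using continuous_attains_sup[OF compact_Icc _ cont] T_pos by force
  \<comment> \<open>The upper estimate is applied at a maximum point with \<open>B\<close> equal to
    the maximum itself, and the resulting inequality is solved for \<open>a t0\<close>.\<close>
  have "a t0 \<le> log_limit t0 - \<gamma> * T * a t0"
    using equilibrium_map_le[OF cont ge t0(2) t0(1)] fixed[OF t0(1)] by simp
  then have *: "a t0 * (1 + \<gamma> * T) \<le> M * (1 + \<gamma> * T)"
    using log_limit_le[OF t0(1)] upper by (simp add: algebra_simps)
  have "0 < M * (1 + \<gamma> * T)" using upper T_pos n_pos by linarith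
  then have "0 < 1 + \<gamma> * T" using M_ge_1 by (simp add: zero_less_mult_iff)
  then have "a t0 \<le> M" using * by simp
  then have "a t \<le> M" if "t \<in> {0..T}" for t using t0(2)[OF that] by linarith
  then show ?fix using cont ge fixed by simp
next
  assume fix': ?fix
  then have cont: "continuous_on {0..T} a" and pos: "\<And>t. t \<in> {0..T} \<Longrightarrow> 0 < a t"
    and fixed: "\<And>t. t \<in> {0..T} \<Longrightarrow> a t = \<Phi> a t" by force+
  have "C1_on_interval 0 T a"
    by (rule C1_on_interval_cong[OF equilibrium_map_C1[OF cont pos]]) (use fixed in auto)
  \<comment> \<open>At time \<open>T\<close> the integral is over a single point and the growth
    factor is 1, which leaves \<open>n * h 0\<close>.\<close>
  moreover have "a T = n"
    using fixed[of T] T_pos h_0 by (simp add: equilibrium_map_def growth_factor_def)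
  ultimately show ?sol
    using pos fixed
    unfolding equilibrium_solution_def equilibrium_map_def growth_factor_def by blast
qed

lemma contraction_const_nonneg: "0 \<le> - \<gamma> * (T * (1 + (1 - \<gamma> * M) * T) + n * T)"
proof -
  have "0 \<le> - \<gamma> * M" using \<gamma>_neg M_ge_1 by (intro mult_nonneg_nonneg) auto
  then show ?thesis using T_pos n_pos \<gamma>_neg
    by (intro mult_nonneg_nonneg add_nonneg_nonneg) auto
qed

text \<open>The contraction estimate is evaluated where the distance between the two solutions is
  largest.\<close>

lemma equilibrium_solution_unique:
  assumes "equilibrium_solution h \<gamma> T n \<gamma> a" "equilibrium_solution h \<gamma> T n \<gamma> b" "t \<in> {0..T}"
  shows "b t = a t"
proof -
  have a: "continuous_on {0..T} a" "\<And>t. t \<in> {0..T} \<Longrightarrow> 1 \<le> a t" "\<And>t. t \<in> {0..T} \<Longrightarrow> a t \<le> M"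
    "\<And>t. t \<in> {0..T} \<Longrightarrow> a t = \<Phi> a t"
    and b: "continuous_on {0..T} b" "\<And>t. t \<in> {0..T} \<Longrightarrow> 1 \<le> b t" "\<And>t. t \<in> {0..T} \<Longrightarrow> b t \<le> M"
    "\<And>t. t \<in> {0..T} \<Longrightarrow> b t = \<Phi> b t"
    using assms(1,2) unfolding equilibrium_solution_iff by auto
  have "continuous_on {0..T} (\<lambda>t. \<bar>a t - b t\<bar>)" by (intro continuous_intros a b)
  then obtain t0 where t0: "t0 \<in> {0..T}" "\<And>t. t \<in> {0..T} \<Longrightarrow> \<bar>a t - b t\<bar> \<le> \<bar>a t0 - b t0\<bar>"
    using continuous_attains_sup[OF compact_Icc, of 0 T "\<lambda>t. \<bar>a t - b t\<bar>"] T_pos by force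
  let ?c = "- \<gamma> * (T * (1 + (1 - \<gamma> * M) * T) + n * T)"
  have "\<bar>a t0 - b t0\<bar> \<le> ?c * \<bar>a t0 - b t0\<bar>"
    using equilibrium_map_diff[OF a(1-3) b(1-3) t0(2) t0(1)] a(4) b(4) t0(1) by simp
  then have "(1 - ?c) * \<bar>a t0 - b t0\<bar> \<le> 0" by (simp add: algebra_simps)
  then have "\<bar>a t0 - b t0\<bar> \<le> 0" using contraction by (simp add: mult_le_0_iff)
  then show ?thesis using t0(2)[OF assms(3)] by simp
qed

lemma equilibrium_solution_exists: "\<exists>a. equilibrium_solution h \<gamma> T n \<gamma> a"
proof -
  \<comment> \<open>The complete metric space used is that of bounded continuous functions on the
    whole line. Composition with the retraction onto \<open>{0..T}\<close> turns images of the
    operator into such functions without changing them on the interval.\<close>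
  define clip where "clip x = max 0 (min T x)" for x
  have clip: "clip x \<in> {0..T}" for x using T_pos by (auto simp: clip_def)
  have clip_id: "clip x = x" if "x \<in> {0..T}" for x using that by (auto simp: clip_def)
  define S where "S = PiC UNIV (\<lambda>_::real. {1..M})"
  define \<Psi> where "\<Psi> f = Bcontfun (\<lambda>x. \<Phi> (apply_bcontfun f) (clip x))" for f
  have S: "continuous_on {0..T} (apply_bcontfun f)" "1 \<le> apply_bcontfun f t" "apply_bcontfun f t \<le> M"
    if "f \<in> S" for f t
    using that by (auto simp: S_def mem_PiC_iff Pi_iff)
  have pos: "0 < apply_bcontfun f t" if "f \<in> S" for f t using S(2)[OF that, of t] by linarith
  have range: "\<Phi> (apply_bcontfun f) (clip x) \<in> {1..M}" if f: "f \<in> S" for f x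
  proof -
    have "\<Phi> (apply_bcontfun f) (clip x) \<le> T + n - \<gamma> * T * M"
      using equilibrium_map_le[OF S[OF f] clip[of x]] log_limit_le[OF clip[of x]] by linarith
    moreover have "1 \<le> \<Phi> (apply_bcontfun f) (clip x)"
      by (intro equilibrium_map_ge_1 clip S[OF f] pos[OF f])
    ultimately show ?thesis using upper by (simp add: algebra_simps)
  qed
  have \<Psi>: "apply_bcontfun (\<Psi> f) x = \<Phi> (apply_bcontfun f) (clip x)" if f: "f \<in> S" for f x
  proof -
    have "continuous_on {0..T} (\<Phi> (apply_bcontfun f))"
      by (intro C1_on_interval_continuous equilibrium_map_C1 S[OF f] pos[OF f])
    moreover have "continuous_on UNIV clip" unfolding clip_def by (intro continuous_intros)
    ultimately have "continuous_on UNIV (\<lambda>x. \<Phi> (apply_bcontfun f) (clip x))"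
      using clip by (intro continuous_on_compose2[of "{0..T}" "\<Phi> (apply_bcontfun f)" UNIV clip]) auto
    moreover have "norm (\<Phi> (apply_bcontfun f) (clip x)) \<le> M" for x
      using range[OF f, of x] by auto
    ultimately have "(\<lambda>x. \<Phi> (apply_bcontfun f) (clip x)) \<in> bcontfun" by (rule bcontfun_normI)
    then show ?thesis by (simp add: \<Psi>_def Bcontfun_inverse)
  qed
  have "\<exists>!f\<in>S. \<Psi> f = f"
  proof (rule Banach_fix[OF _ _ contraction_const_nonneg contraction])
    show "complete S" unfolding S_def by (simp add: complete_eq_closed closed_PiC)
    have "const_bcontfun 1 \<in> S" using M_ge_1 by (simp add: S_def mem_PiC_iff const_bcontfun.rep_eq)
    then show "S \<noteq> {}" by blast
    show "\<Psi> ` S \<subseteq> S" using \<Psi> range by (auto simp: S_def mem_PiC_iff Pi_iff)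
  next
    fix f g assume f: "f \<in> S" and g: "g \<in> S"
    show "dist (\<Psi> f) (\<Psi> g) \<le> - \<gamma> * (T * (1 + (1 - \<gamma> * M) * T) + n * T) * dist f g"
    proof (rule dist_bound)
      fix x
      have "\<bar>\<Phi> (apply_bcontfun f) (clip x) - \<Phi> (apply_bcontfun g) (clip x)\<bar>
          \<le> - \<gamma> * (T * (1 + (1 - \<gamma> * M) * T) + n * T) * dist f g"
        by (rule equilibrium_map_diff[OF S[OF f] S[OF g] _ clip])
          (use dist_bounded[of f _ g] in \<open>auto simp: dist_real_def\<close>)
      then show "dist (apply_bcontfun (\<Psi> f) x) (apply_bcontfun (\<Psi> g) x)
          \<le> - \<gamma> * (T * (1 + (1 - \<gamma> * M) * T) + n * T) * dist f g"
        by (simp add: \<Psi> f g dist_real_def)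
    qed
  qed
  then obtain f where f: "f \<in> S" "\<Psi> f = f" by blast
  have "apply_bcontfun f t = \<Phi> (apply_bcontfun f) t" if "t \<in> {0..T}" for t
    using \<Psi>[OF f(1), of t] unfolding f(2) clip_id[OF that] .
  moreover have f_range: "apply_bcontfun f t \<in> {1..M}" for t using S[OF f(1)] by simp
  ultimately have "equilibrium_solution h \<gamma> T n \<gamma> (apply_bcontfun f)"
    unfolding equilibrium_solution_iff using S(1)[OF f(1)] f_range by blast
  then show ?thesis by blast
qed

lemma equilibrium_solution_bounds:
  assumes "equilibrium_solution h \<gamma> T n \<gamma> a" "t \<in> {0..T}"
  shows "exp (\<gamma> * T) * log_limit t \<le> a t" and "a t \<le> log_limit t - \<gamma> * T * M"
proof -
  have a: "continuous_on {0..T} a" "\<And>t. t \<in> {0..T} \<Longrightarrow> 1 \<le> a t" "\<And>t. t \<in> {0..T} \<Longrightarrow> a t \<le> M"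
    and fixed: "a t = \<Phi> a t"
    using assms unfolding equilibrium_solution_iff by auto
  show "exp (\<gamma> * T) * log_limit t \<le> a t"
    using equilibrium_map_ge[OF a(1,2) assms(2)] fixed by linarith
  show "a t \<le> log_limit t - \<gamma> * T * M"
    using equilibrium_map_le[OF a assms(2)] fixed by linarith
qed

end

section \<open>Hyperbolic discounting and the concrete parameters\<close>

lemma hyperbolic_discount_2:
  assumes "0 < k" "0 \<le> t"
  shows "hyperbolic_discount k (2 * k) t = 1 / (1 + k * t)\<^sup>2"
proof -
  have "0 < 1 + k * t" using assms by (intro add_pos_nonneg) auto
  then show ?thesis using assms by (simp add: hyperbolic_discount_def powr_minus_divide powr_numeral)
qed

text \<open>With \<open>x = s - t\<close>, the function \<open>x / (1 + k * x)\<close> is an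
  antiderivative of \<open>1 / (1 + k * x)\<^sup>2\<close>.\<close>

lemma integral_hyperbolic_discount_2:
  assumes "0 < k" "t \<le> T"
  shows "integral {t..T} (\<lambda>s. hyperbolic_discount k (2 * k) (s - t)) = (T - t) / (1 + k * (T - t))"
proof -
  have pos: "0 < 1 + k * (s - t)" if "t \<le> s" for s
    using that assms(1) by (intro add_pos_nonneg) auto
  have "((\<lambda>s. hyperbolic_discount k (2 * k) (s - t)) has_integral (T - t) / (1 + k * (T - t)) - (t - t) / (1 + k * (t - t))) {t..T}"
  proof (rule fundamental_theorem_of_calculus[OF assms(2)])
    fix s assume s: "s \<in> {t..T}"
    have "hyperbolic_discount k (2 * k) (s - t) = 1 / (1 + k * (s - t))\<^sup>2"
      using hyperbolic_discount_2[OF assms(1)] s by simp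
    then have "((\<lambda>s. (s - t) / (1 + k * (s - t))) has_real_derivative hyperbolic_discount k (2 * k) (s - t)) (at s within {t..T})"
      using pos[of s] s
      by (auto intro!: derivative_eq_intros simp: power2_eq_square algebra_simps)
    then show "((\<lambda>s. (s - t) / (1 + k * (s - t))) has_vector_derivative hyperbolic_discount k (2 * k) (s - t)) (at s within {t..T})"
      by (simp add: has_real_derivative_iff_has_vector_derivative)
  qed
  then show ?thesis by (simp add: integral_unique)
qed

lemma hyperbolic_discount_C1:
  assumes "0 < k1"
  shows "C1_on_interval 0 T (hyperbolic_discount k1 k2)"
proof -
  have pos: "0 < 1 + k1 * t" if "0 \<le> t" for t using that assms by (intro add_pos_nonneg) auto
  have "(hyperbolic_discount k1 k2 has_real_derivative - k2 * (1 + k1 * t) powr (- k2 / k1 - 1))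
      (at t within {0..T})" if "t \<in> {0..T}" for t
    unfolding hyperbolic_discount_def using pos[of t] that assms
    by (auto intro!: derivative_eq_intros simp: powr_diff)
  moreover have "continuous_on {0..T} (\<lambda>t. - k2 * (1 + k1 * t) powr (- k2 / k1 - 1))"
    using pos by (intro continuous_intros) (auto simp: less_imp_neq[symmetric])
  ultimately show ?thesis unfolding C1_on_interval_def
    by (intro exI[of _ "\<lambda>t. - k2 * (1 + k1 * t) powr (- k2 / k1 - 1)"]) simp
qed

theorem lemma5p6:
  "\<exists>(T::real) (r::real) (\<mu>::real) (\<sigma>::real) (n::real) (\<gamma>::real) (k1::real) (k2::real).
     T > 0 \<and> r > 0 \<and> \<mu> > 0 \<and> \<sigma> > 0 \<and> n > 0 \<and> \<gamma> < 1 \<and> \<gamma> \<noteq> 0 \<and> k1 > 0 \<and> k2 > 0 \<and>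
     (\<exists>a. equilibrium_solution (hyperbolic_discount k1 k2) (merton_K r \<mu> \<sigma> \<gamma>) T n \<gamma> a \<and>
          (\<forall>b. equilibrium_solution (hyperbolic_discount k1 k2) (merton_K r \<mu> \<sigma> \<gamma>) T n \<gamma> b
               \<longrightarrow> (\<forall>t\<in>{0..T}. b t = a t)) \<and>
          \<not> mono_on {0..T} (consumption_rate \<gamma> a) \<and>
          \<not> antimono_on {0..T} (consumption_rate \<gamma> a))"
proof -
  define k \<epsilon> :: real where "k = 1 / 24" and "\<epsilon> = 1 / 10 ^ 5"
  define h where "h = hyperbolic_discount k (2 * k)"
  have h: "h t = 1 / (1 + t / 24)\<^sup>2" if "0 \<le> t" for t
    using hyperbolic_discount_2[of k t] that by (simp add: h_def k_def)
  have exp_ge: "1 - 48 * \<epsilon> \<le> exp (- \<epsilon> * 48)" using exp_ge_add_one_self[of "- \<epsilon> * 48"] by simp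
  \<comment> \<open>\<open>M = 67\<close> lies just above \<open>T + n = 66\<close>, and
    \<open>n * h T = 18 / 9 = 2\<close> leaves room in \<open>lower\<close>. The contraction
    constant is about 0.03.\<close>
  interpret near_log_merton h 48 18 "- \<epsilon>" 67
  proof
    show "C1_on_interval 0 48 h" unfolding h_def by (rule hyperbolic_discount_C1) (simp add: k_def)
    show "h 0 = 1" by (simp add: h)
    fix t :: real assume t: "t \<in> {0..48}"
    show "h t \<le> 1" using t by (simp add: h divide_le_eq_1 one_le_power)
    have "(1 + t / 24)\<^sup>2 \<le> 3\<^sup>2" using t by (intro power_mono) auto
    then show "h 48 \<le> h t" using t by (auto simp: h intro!: divide_left_mono)
  qed (use exp_ge in \<open>simp_all add: \<epsilon>_def h power2_eq_square\<close>)
  have K: "merton_K (1 / 2) (sqrt (1 + \<epsilon>)) 1 (- \<epsilon>) = - \<epsilon>"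
    by (simp add: merton_K_def \<epsilon>_def)
  have "log_limit t = (48 - t) / (1 + (48 - t) / 24) + 18 * h (48 - t)" if "t \<le> 48" for t
    using integral_hyperbolic_discount_2[of k t 48, folded h_def] that
    unfolding log_limit_def by (simp add: k_def)
  then have limit: "log_limit 0 = 18" "log_limit 36 = 16" "log_limit 48 = 18"
    by (simp_all add: h power2_eq_square)
  obtain a where a: "equilibrium_solution h (- \<epsilon>) 48 18 (- \<epsilon>) a"
    using equilibrium_solution_exists by blast
  note lo = equilibrium_solution_bounds(1)[OF a] and up = equilibrium_solution_bounds(2)[OF a]
  \<comment> \<open>The threshold 17 separates the limit values 16 and 18. The upper error
    \<open>48 * 67 * \<epsilon>\<close> is about 0.03, and the lower bounds lose at most the
    fraction \<open>48 * \<epsilon>\<close>.\<close>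
  have a36: "0 < a 36" "a 36 < 17"
    using lo[of 36] up[of 36] exp_ge by (auto simp: limit \<epsilon>_def)
  have a0: "17 < a 0" using lo[of 0] exp_ge by (simp add: limit \<epsilon>_def)
  have a48: "17 < a 48" using lo[of 48] exp_ge by (simp add: limit \<epsilon>_def)
  \<comment> \<open>The exponent \<open>1 / (\<gamma> - 1)\<close> is negative, so the dip of
    \<open>a\<close> at time 36 becomes a peak of the consumption rate, above its values at both
    ends.\<close>
  have rate: "consumption_rate (- \<epsilon>) a t < consumption_rate (- \<epsilon>) a 36" if "17 < a t" for t
    unfolding consumption_rate_def using that a36
    by (intro powr_less_mono2_neg) (auto simp: \<epsilon>_def)
  have "\<not> mono_on {0..48} (consumption_rate (- \<epsilon>) a)"
  proof
    assume "mono_on {0..48} (consumption_rate (- \<epsilon>) a)"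
    from monotone_onD[OF this, of 36 48] rate[OF a48] show False by simp
  qed
  moreover have "\<not> antimono_on {0..48} (consumption_rate (- \<epsilon>) a)"
  proof
    assume "antimono_on {0..48} (consumption_rate (- \<epsilon>) a)"
    from monotone_onD[OF this, of 0 36] rate[OF a0] show False by simp
  qed
  ultimately have "\<exists>a. equilibrium_solution h (- \<epsilon>) 48 18 (- \<epsilon>) a \<and>
      (\<forall>b. equilibrium_solution h (- \<epsilon>) 48 18 (- \<epsilon>) b \<longrightarrow> (\<forall>t\<in>{0..48}. b t = a t)) \<and>
      \<not> mono_on {0..48} (consumption_rate (- \<epsilon>) a) \<and>
      \<not> antimono_on {0..48} (consumption_rate (- \<epsilon>) a)"
    using a equilibrium_solution_unique[OF a] by blast
  moreover have "0 < \<epsilon>" "0 < k" by (simp_all add: \<epsilon>_def k_def)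
  ultimately show ?thesis
    by - (rule exI[of _ 48], rule exI[of _ "1 / 2"], rule exI[of _ "sqrt (1 + \<epsilon>)"], rule exI[of _ 1],
        rule exI[of _ 18], rule exI[of _ "- \<epsilon>"], rule exI[of _ k], rule exI[of _ "2 * k"],
        unfold K h_def[symmetric], simp)
qed

end
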